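(* Let $\mathcal{R}:\mathbb{R}^V\to\mathbb{R}^V$ be the residual function defined in the context, with $\mathcal{H}$ satisfying (H1), (H2) and (H3) (with constant $\lambda>0$), and let $\bar u$ be the unique solution to $\mathcal{R}(\bar u)=0$. Then, for any $u\in\mathbb{R}^V$, $$\|u-\bar u\|_{\ell^\infty(V)}\le\max\Big(\frac1\lambda\|\mathcal{R}(u)\|_{\ell^\infty(\mathcal{J})},\ \|u-g\|_{\ell^\infty(\mathcal{B})}\Big).$$
   Context: Setting. $V$ is a finite index set, $\{x_j\}_{j\in V}$ are nodes which are the vertices of a directed graph; $\mathcal{V}_j\subset V$ is the set of (out-)neighbors of $j$, with $j\notin\mathcal{V}_j$. Put $\mathcal{J}:=\{j\in V:\mathcal{V}_j\neq\emptyset\}$ and $\mathcal{B}:=\{j\in V:\mathcal{V}_j=\emptyset\}$, both assumed non-empty. For $k\in\mathcal{V}_j$, $\Delta x_{jk}>0$ is the distance between $x_j$ and $x_k$. For $u\in\mathbb{R}^V$ and $j\in\mathcal{J}$, $\nabla_G u_j:=\{(u_j-u_k)/\Delta x_{jk}\}_{k\in\mathcal{V}_j}\in\mathbb{R}^{|\mathcal{V}_j|}$. For each $j\in\mathcal{J}$ a numerical Hamiltonian $\mathcal{H}(x_j,\cdot,\cdot):\mathbb{R}\times\mathbb{R}^{|\mathcal{V}_j|}\to\mathbb{R}$ is given. Boundary values $g=\{g_j\}_{j\in\mathcal{B}}$ are given. For $W\subset V$, $\|u\|_{\ell^\infty(W)}:=\max_{j\in W}|u_j|$. Residual: for a constant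 $\lambda_b>0$, $\mathcal{R}(u)_j:=\mathcal{H}(x_j,u_j,\nabla_G u_j)$ for $j\in\mathcal{J}$ and $\mathcal{R}(u)_j:=\lambda_b(u_j-g_j)$ for $j\in\mathcal{B}$. Hypotheses. (H1) There are constants $[\mathcal{H}]_u,[\mathcal{H}]_p>0$, independent of $x_j$, such that $|\mathcal{H}(x_j,u,p)-\mathcal{H}(x_j,v,p)|\le[\mathcal{H}]_u|u-v|$ and $|\mathcal{H}(x_j,u,p)-\mathcal{H}(x_j,u,q)|\le[\mathcal{H}]_p\|p-q\|_\infty$ for all $j\in\mathcal{J}$, $u,v\in\mathbb{R}$, $p,q\in\mathbb{R}^{|\mathcal{V}_j|}$. (H2) For all $j\in\mathcal{J}$, $u,v\in\mathbb{R}$, $p,q\in\mathbb{R}^{|\mathcal{V}_j|}$: $p\le q$ componentwise implies $\mathcal{H}(x_j,u,p)\le\mathcal{H}(x_j,u,q)$; and $u\le v$ implies $\mathcal{H}(x_j,u,p)\le\mathcal{H}(x_j,v,p)$. (H3) There is $\lambda>0$ such that for all $j\in\mathcal{J}$, $u,v\in\mathbb{R}$, $p\in\mathbb{R}^{|\mathcal{V}_j|}$: $v\ge u$ implies $\mathcal{H}(x_j,v,p)-\mathcal{H}(x_j,u,p)\ge\lambda(v-u)$. Under these hypotheses $\mathcal{R}(\bar u)=0$ has exactly one solution $\bar u\in\mathbb{R}^V$. *)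

theory Defs
  imports "HOL-Analysis.Analysis"
begin

text \<open>
  The index set \<open>V\<close> is the finite type \<open>'v\<close>, so \<open>\<real>\<^sup>V\<close> is \<open>real ^ 'v\<close>. The directed graph is given
  by its out-neighbour map \<open>N :: 'v \<Rightarrow> 'v set\<close>. A vector \<open>p\<close> indexed by \<open>N j\<close> is an element of
  \<open>N j \<rightarrow>\<^sub>E UNIV\<close>, i.e. a function on \<open>N j\<close> with the fixed dummy value \<open>undefined\<close> outside.
  \<open>H j\<close> is the Hamiltonian at the node with index \<open>j\<close>; it only matters on such vectors and for
  \<open>j \<in> interior_nodes N\<close>.
\<close>

definition interior_nodes :: "('v \<Rightarrow> 'v set) \<Rightarrow> 'v set" where
  "interior_nodes N = {j. N j \<noteq> {}}"

definition boundary_nodes :: "('v \<Rightarrow> 'v set) \<Rightarrow> 'v set" where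
  "boundary_nodes N = {j. N j = {}}"

text \<open>Intended for finite non-empty \<open>W\<close> only, since \<open>Max {}\<close> is unspecified.\<close>

definition linf_norm_on :: "'v set \<Rightarrow> ('v \<Rightarrow> real) \<Rightarrow> real" where
  "linf_norm_on W f = Max ((\<lambda>j. \<bar>f j\<bar>) ` W)"

definition graph_gradient ::
  "('v \<Rightarrow> 'v set) \<Rightarrow> ('v \<Rightarrow> 'v \<Rightarrow> real) \<Rightarrow> real ^ 'v \<Rightarrow> 'v \<Rightarrow> ('v \<Rightarrow> real)" where
  "graph_gradient N dx u j = (\<lambda>k\<in>N j. (u $ j - u $ k) / dx j k)"

text \<open>Only the values of \<open>g\<close> on \<open>boundary_nodes N\<close> are used.\<close>

definition residual ::
  "('v \<Rightarrow> 'v set) \<Rightarrow> ('v \<Rightarrow> 'v \<Rightarrow> real) \<Rightarrow> ('v \<Rightarrow> real \<Rightarrow> ('v \<Rightarrow> real) \<Rightarrow> real)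
    \<Rightarrow> real \<Rightarrow> ('v \<Rightarrow> real) \<Rightarrow> real ^ 'v \<Rightarrow> real ^ 'v" where
  "residual N dx H lamb g u =
    (\<chi> j. if j \<in> interior_nodes N then H j (u $ j) (graph_gradient N dx u j)
          else lamb * (u $ j - g j))"

definition hamiltonian_lipschitz ::
  "('v \<Rightarrow> 'v set) \<Rightarrow> ('v \<Rightarrow> real \<Rightarrow> ('v \<Rightarrow> real) \<Rightarrow> real) \<Rightarrow> real \<Rightarrow> real \<Rightarrow> bool" where
  "hamiltonian_lipschitz N H Lu Lp \<longleftrightarrow>
    (\<forall>j\<in>interior_nodes N. \<forall>u v. \<forall>p\<in>N j \<rightarrow>\<^sub>E UNIV. \<forall>q\<in>N j \<rightarrow>\<^sub>E UNIV.
      \<bar>H j u p - H j v p\<bar> \<le> Lu * \<bar>u - v\<bar> \<and>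
      \<bar>H j u p - H j u q\<bar> \<le> Lp * linf_norm_on (N j) (\<lambda>k. p k - q k))"

definition hamiltonian_monotone ::
  "('v \<Rightarrow> 'v set) \<Rightarrow> ('v \<Rightarrow> real \<Rightarrow> ('v \<Rightarrow> real) \<Rightarrow> real) \<Rightarrow> bool" where
  "hamiltonian_monotone N H \<longleftrightarrow>
    (\<forall>j\<in>interior_nodes N. \<forall>u v. \<forall>p\<in>N j \<rightarrow>\<^sub>E UNIV. \<forall>q\<in>N j \<rightarrow>\<^sub>E UNIV.
      ((\<forall>k\<in>N j. p k \<le> q k) \<longrightarrow> H j u p \<le> H j u q) \<and>
      (u \<le> v \<longrightarrow> H j u p \<le> H j v p))"

definition hamiltonian_strictly_increasing ::
  "('v \<Rightarrow> 'v set) \<Rightarrow> ('v \<Rightarrow> real \<Rightarrow> ('v \<Rightarrow> real) \<Rightarrow> real) \<Rightarrow> real \<Rightarrow> bool" where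
  "hamiltonian_strictly_increasing N H lam \<longleftrightarrow>
    (\<forall>j\<in>interior_nodes N. \<forall>u v. \<forall>p\<in>N j \<rightarrow>\<^sub>E UNIV.
      u \<le> v \<longrightarrow> lam * (v - u) \<le> H j v p - H j u p)"

end

theory Submission
  imports Defs
begin

text \<open>
  The estimate is a discrete maximum principle. Take a node \<open>j\<close> at which
  \<open>\<bar>u - ubar\<bar>\<close> is largest, and suppose that \<open>j\<close> has neighbours and \<open>u $ j \<ge> ubar $ j\<close>.
  Then \<open>u - ubar\<close> is maximal at \<open>j\<close>, so every difference \<open>u $ j - u $ k\<close> dominates
  \<open>ubar $ j - ubar $ k\<close>: the discrete gradients are ordered componentwise. Monotonicity of the
  Hamiltonian in the gradient and its strict growth, with slope \<open>lam\<close>, in the value of the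
  function then turn the ordering into
  \<open>lam * (u $ j - ubar $ j) \<le> \<R>(u)\<^sub>j - \<R>(ubar)\<^sub>j = \<R>(u)\<^sub>j\<close>; this is the lemma
  \<open>residual_diff_ge_at_max\<close>. If \<open>u $ j < ubar $ j\<close>, the same lemma with the roles of \<open>u\<close> and
  \<open>ubar\<close> exchanged bounds the error by \<open>- \<R>(u)\<^sub>j\<close>. If instead \<open>j\<close> has no neighbours,
  then \<open>ubar $ j = g j\<close> and the error at \<open>j\<close> is itself the boundary mismatch.
\<close>

lemma abs_le_linf_norm_on:
  assumes "finite W" "j \<in> W"
  shows "\<bar>f j\<bar> \<le> linf_norm_on W f"
  using assms by (simp add: linf_norm_on_def)

lemma linf_norm_on_attained:
  assumes "finite W" "W \<noteq> {}"
  obtains j where "j \<in> W" "linf_norm_on W f = \<bar>f j\<bar>"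
proof -
  have "Max ((\<lambda>j. \<bar>f j\<bar>) ` W) \<in> (\<lambda>j. \<bar>f j\<bar>) ` W"
    using assms by (intro Max_in) auto
  then show ?thesis
    using that by (auto simp: linf_norm_on_def)
qed

lemma residual_interior:
  "j \<in> interior_nodes N \<Longrightarrow>
    residual N dx H lamb g u $ j = H j (u $ j) (graph_gradient N dx u j)"
  by (simp add: residual_def)

lemma residual_boundary:
  "j \<notin> interior_nodes N \<Longrightarrow> residual N dx H lamb g u $ j = lamb * (u $ j - g j)"
  by (simp add: residual_def)

lemma graph_gradient_extensional: "graph_gradient N dx u j \<in> N j \<rightarrow>\<^sub>E UNIV"
  by (simp add: graph_gradient_def)

text \<open>
  Where \<open>w - z\<close> has a maximum relative to the neighbours, \<open>w\<close> rises from each neighbour to \<open>j\<close>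
  at least as steeply as \<open>z\<close> does.
\<close>

lemma graph_gradient_mono_at_max:
  assumes "\<And>k. k \<in> N j \<Longrightarrow> w $ k - z $ k \<le> w $ j - z $ j"
    and "\<And>k. k \<in> N j \<Longrightarrow> dx j k > 0"
    and "k \<in> N j"
  shows "graph_gradient N dx z j k \<le> graph_gradient N dx w j k"
  using assms(1)[OF assms(3)] assms(2)[OF assms(3)] assms(3)
  by (simp add: graph_gradient_def divide_right_mono)

text \<open>
  The comparison step: at a nonnegative maximum of \<open>w - z\<close>, the neighbours can only enlarge the
  difference of the residuals, so the growth of the Hamiltonian in its scalar argument controls
  \<open>w - z\<close> there. The lemma is symmetric in the two functions, which gives both signs of the error.
\<close>

lemma residual_diff_ge_at_max:
  assumes mono: "hamiltonian_monotone N H"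
    and incr: "hamiltonian_strictly_increasing N H lam"
    and j: "j \<in> interior_nodes N"
    and dx_pos: "\<And>k. k \<in> N j \<Longrightarrow> dx j k > 0"
    and nonneg: "z $ j \<le> w $ j"
    and max: "\<And>k. k \<in> N j \<Longrightarrow> w $ k - z $ k \<le> w $ j - z $ j"
  shows "lam * (w $ j - z $ j) \<le> residual N dx H lamb g w $ j - residual N dx H lamb g z $ j"
proof -
  let ?p = "graph_gradient N dx w j" and ?q = "graph_gradient N dx z j"
  have "\<forall>k\<in>N j. ?q k \<le> ?p k"
    by (intro ballI graph_gradient_mono_at_max) (use max dx_pos in auto)
  then have "H j (w $ j) ?q \<le> H j (w $ j) ?p"
    using mono j graph_gradient_extensional[of N dx w j] graph_gradient_extensional[of N dx z j]
    by (simp add: hamiltonian_monotone_def)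
  moreover have "lam * (w $ j - z $ j) \<le> H j (w $ j) ?q - H j (z $ j) ?q"
    using incr j nonneg graph_gradient_extensional[of N dx z j]
    by (simp add: hamiltonian_strictly_increasing_def)
  ultimately show ?thesis
    using j by (simp add: residual_interior)
qed

theorem theorem3:
  fixes N :: "'v::finite \<Rightarrow> 'v set"
    and dx :: "'v \<Rightarrow> 'v \<Rightarrow> real"
    and H :: "'v \<Rightarrow> real \<Rightarrow> ('v \<Rightarrow> real) \<Rightarrow> real"
    and g :: "'v \<Rightarrow> real"
    and Lu Lp lam lamb :: real
    and u ubar :: "real ^ 'v"
  assumes no_loops: "\<And>j. j \<notin> N j"
    and interior: "interior_nodes N \<noteq> {}"
    and boundary: "boundary_nodes N \<noteq> {}"
    and dx_pos: "\<And>j k. k \<in> N j \<Longrightarrow> dx j k > 0"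
    and lamb_pos: "lamb > 0"
    and Lu_pos: "Lu > 0" and Lp_pos: "Lp > 0"
    and H1: "hamiltonian_lipschitz N H Lu Lp"
    and H2: "hamiltonian_monotone N H"
    and lam_pos: "lam > 0"
    and H3: "hamiltonian_strictly_increasing N H lam"
    and ubar: "residual N dx H lamb g ubar = 0"
  shows "linf_norm_on UNIV (\<lambda>j. u $ j - ubar $ j)
    \<le> max (1 / lam * linf_norm_on (interior_nodes N) (\<lambda>j. residual N dx H lamb g u $ j))
          (linf_norm_on (boundary_nodes N) (\<lambda>j. u $ j - g j))"
proof -
  let ?R = "residual N dx H lamb g"
  let ?e = "\<lambda>j. u $ j - ubar $ j"
  obtain j where j: "linf_norm_on UNIV ?e = \<bar>?e j\<bar>"
    using linf_norm_on_attained[of UNIV ?e] by auto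
  have max: "\<bar>?e k\<bar> \<le> \<bar>?e j\<bar>" for k
    using abs_le_linf_norm_on[of UNIV k ?e] j by simp
  show ?thesis
  proof (cases "j \<in> interior_nodes N")
    case True
    have "lam * \<bar>?e j\<bar> \<le> \<bar>?R u $ j\<bar>"
    proof (cases "ubar $ j \<le> u $ j")
      case above: True
      have "?e k \<le> ?e j" for k
        using max[of k] above by linarith
      with above have "lam * ?e j \<le> ?R u $ j - ?R ubar $ j"
        by (intro residual_diff_ge_at_max[OF H2 H3 True dx_pos]) auto
      then show ?thesis
        using above ubar by simp
    next
      case below: False
      have "ubar $ k - u $ k \<le> ubar $ j - u $ j" for k
        using max[of k] below by linarith
      with below have "lam * (ubar $ j - u $ j) \<le> ?R ubar $ j - ?R u $ j"
        by (intro residual_diff_ge_at_max[OF H2 H3 True dx_pos]) auto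
      then show ?thesis
        using below ubar by simp
    qed
    also have "\<dots> \<le> linf_norm_on (interior_nodes N) (\<lambda>j. ?R u $ j)"
      using True by (intro abs_le_linf_norm_on) auto
    finally have "\<bar>?e j\<bar> \<le> 1 / lam * linf_norm_on (interior_nodes N) (\<lambda>j. ?R u $ j)"
      using lam_pos by (simp add: field_simps)
    then show ?thesis
      using j by simp
  next
    case False
    have "lamb * (ubar $ j - g j) = 0"
      using residual_boundary[OF False, of dx H lamb g ubar] ubar by simp
    then have "?e j = u $ j - g j"
      using lamb_pos by simp
    moreover have "j \<in> boundary_nodes N"
      using False by (simp add: interior_nodes_def boundary_nodes_def)
    ultimately have "\<bar>?e j\<bar> \<le> linf_norm_on (boundary_nodes N) (\<lambda>j. u $ j - g j)"
      using abs_le_linf_norm_on[of "boundary_nodes N" j "\<lambda>j. u $ j - g j"] by simp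
    then show ?thesis
      using j by simp
  qed
qed

end
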